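(* Let $d,n\ge1$ and let $H^{(1)},\dots,H^{(n)}$ be $d\times d$ Hadamard matrices (possibly distinct, not necessarily self-transpose). Then the isometry $$i:\mathbb{C}^d\to(\mathbb{C}^d)^{\otimes n},\qquad i\,|k\rangle=H^{(1)}|k\rangle\otimes H^{(2)}|k\rangle\otimes\cdots\otimes H^{(n)}|k\rangle\quad(0\le k\le d-1)$$ gives an $[[n,1,n]]^{\mathcal P}_d$ code, where $\mathcal P\subset U(d)$ is the group of diagonal unitary matrices; that is, for every $(n,\mathcal P)$-local operator $e$ on $(\mathbb{C}^d)^{\otimes n}$ the composite $i^\dagger\circ e\circ i$ is proportional to the identity on $\mathbb{C}^d$.
   Context: A Hadamard matrix here is a unitary matrix all of whose entries have the same absolute value. For a subgroup $\mathcal E\subseteq U(d)$, an operator $e$ on $(\mathbb{C}^d)^{\otimes n}$ is $(p,\mathcal E)$-local when $e=U_1\otimes\cdots\otimes U_n$ with all $U_i\in\mathcal E$ and at most $p-1$ of the $U_i$ different from the identity. By the Knill–Laflamme theorem, an isometry $i:(\mathbb{C}^d)^{\otimes k}\to(\mathbb{C}^d)^{\otimes n}$ gives an $[[n,k,p]]^{\mathcal E}_d$ code exactly when $i^\dagger\circ e\circ i$ is proportional to the identity (any factor allowed, including $0$) for every $(p,\mathcal E)$-local $e$; this is taken as the criterion here. *)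

theory Defs
  imports "HOL-Analysis.Analysis" "HOL-Algebra.Group"
begin

text \<open>
  The dimension \<open>d\<close> is \<open>CARD('d)\<close> and the number of tensor factors is \<open>CARD('n)\<close>, both at least 1
  because types are nonempty.  The computational basis of \<open>(\<complex>\<^sup>d)\<^sup>\<otimes>\<^sup>n\<close> is indexed by the
  words \<open>'n \<Rightarrow> 'd\<close>, so this space is \<open>complex ^ ('n \<Rightarrow> 'd)\<close>, and a linear map from the \<open>k\<close>-fold to
  the \<open>n\<close>-fold tensor power is a matrix of type \<open>complex ^ ('k \<Rightarrow> 'd) ^ ('n \<Rightarrow> 'd)\<close>
  (rows indexed by \<open>'n \<Rightarrow> 'd\<close>, columns by \<open>'k \<Rightarrow> 'd\<close>).
\<close>

definition ket :: "'a \<Rightarrow> complex ^ 'a::finite" where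
  "ket a = axis a 1"

definition tensor_vec :: "('n \<Rightarrow> complex ^ 'd) \<Rightarrow> complex ^ ('n::finite \<Rightarrow> 'd::finite)" where
  "tensor_vec v = (\<chi> x. \<Prod>j\<in>UNIV. v j $ x j)"

definition tensor_op ::
  "('n \<Rightarrow> complex ^ 'd ^ 'd) \<Rightarrow> complex ^ ('n::finite \<Rightarrow> 'd::finite) ^ ('n \<Rightarrow> 'd)" where
  "tensor_op U = (\<chi> x y. \<Prod>j\<in>UNIV. U j $ x j $ y j)"

definition dagger :: "complex ^ 'a ^ 'b \<Rightarrow> complex ^ 'b::finite ^ 'a::finite" where
  "dagger A = (\<chi> i j. cnj (A $ j $ i))"

definition is_isometry :: "complex ^ 'a::finite ^ 'b::finite \<Rightarrow> bool" where
  "is_isometry A \<longleftrightarrow> dagger A ** A = mat 1"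

definition is_unitary :: "complex ^ 'a::finite ^ 'a \<Rightarrow> bool" where
  "is_unitary U \<longleftrightarrow> dagger U ** U = mat 1 \<and> U ** dagger U = mat 1"

definition unitary_group :: "(complex ^ 'd::finite ^ 'd) monoid" where
  "unitary_group = \<lparr>carrier = {U. is_unitary U}, mult = (**), one = mat 1\<rparr>"

definition diagonal_unitaries :: "(complex ^ 'd::finite ^ 'd) set" where
  "diagonal_unitaries = {U. is_unitary U \<and> (\<forall>i j. i \<noteq> j \<longrightarrow> U $ i $ j = 0)}"

definition is_hadamard :: "complex ^ 'd::finite ^ 'd \<Rightarrow> bool" where
  "is_hadamard H \<longleftrightarrow> is_unitary H \<and> (\<forall>i j i' j'. cmod (H $ i $ j) = cmod (H $ i' $ j'))"

text \<open>``At most \<open>p - 1\<close>'' is rendered as \<open>< p\<close> to avoid truncated subtraction.\<close>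

definition is_local_op ::
  "nat \<Rightarrow> (complex ^ 'd ^ 'd) set \<Rightarrow> complex ^ ('n::finite \<Rightarrow> 'd::finite) ^ ('n \<Rightarrow> 'd) \<Rightarrow> bool" where
  "is_local_op p E e \<longleftrightarrow>
     (\<exists>U. (\<forall>j. U j \<in> E) \<and> card {j. U j \<noteq> mat 1} < p \<and> e = tensor_op U)"

text \<open>
  \<open>i\<close> gives an \<open>[[n,k,p]]\<close> code over \<open>E\<close>, with \<open>n = CARD('n)\<close>, \<open>k = CARD('k)\<close>, by the
  Knill--Laflamme criterion; \<open>mat c\<close> is \<open>c\<close> times the identity matrix.
\<close>

definition is_quantum_code ::
  "nat \<Rightarrow> (complex ^ 'd ^ 'd) set
   \<Rightarrow> complex ^ ('k::finite \<Rightarrow> 'd::finite) ^ ('n::finite \<Rightarrow> 'd) \<Rightarrow> bool" where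
  "is_quantum_code p E i \<longleftrightarrow>
     subgroup E unitary_group \<and> is_isometry i \<and>
     (\<forall>e. is_local_op p E e \<longrightarrow> (\<exists>c. dagger i ** e ** i = mat c))"

text \<open>
  The domain \<open>\<complex>\<^sup>d\<close> is the one-fold tensor power, with the one-element index type \<open>1\<close>; the basis
  vector \<open>|k\<rangle>\<close> of \<open>\<complex>\<^sup>d\<close> corresponds to the constant word \<open>\<lambda>_. k\<close>.
\<close>

definition hadamard_encoder ::
  "('n \<Rightarrow> complex ^ 'd ^ 'd) \<Rightarrow> complex ^ (1 \<Rightarrow> 'd::finite) ^ ('n::finite \<Rightarrow> 'd)" where
  "hadamard_encoder H = (\<chi> x w. tensor_vec (\<lambda>j. H j *v ket (w 1)) $ x)"

lemma hadamard_encoder_ket: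
  "hadamard_encoder H *v ket (\<lambda>_. k) = tensor_vec (\<lambda>j. H j *v ket k)"
  by (simp add: hadamard_encoder_def ket_def vec_eq_iff matrix_vector_mult_def axis_def
      if_distrib[of "(*) _"] cong: if_cong)

end

theory Submission
  imports Defs
begin

text \<open>
  For \<open>e = U\<^sub>1 \<otimes> \<dots> \<otimes> U\<^sub>n\<close> the \<open>(a, b)\<close> entry of \<open>i\<^sup>\<dagger> e i\<close> factorises as the
  product over \<open>j\<close> of the \<open>(a, b)\<close> entries of \<open>H\<^sub>j\<^sup>\<dagger> U\<^sub>j H\<^sub>j\<close>.  Fewer than \<open>n\<close> of the \<open>U\<^sub>j\<close>
  are nontrivial, so some factor is \<open>H\<^sub>j\<^sup>\<dagger> H\<^sub>j = 1\<close>, which kills every off-diagonal entry.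
  On the diagonal, since \<open>U\<^sub>j\<close> is diagonal, the \<open>j\<close>-th factor only involves the squared moduli of
  the entries of column \<open>a\<close> of \<open>H\<^sub>j\<close>, and these do not depend on \<open>a\<close>.
\<close>

text \<open>Distributivity, with the choice functions ranging over the whole type
  \<open>'n \<Rightarrow> 'd\<close>. It turns a contraction over words into a product of
  contractions over sites.\<close>

lemma prod_sum_UNIV:
  fixes f :: "'n::finite \<Rightarrow> 'd::finite \<Rightarrow> 'a::comm_semiring_1"
  shows "(\<Prod>j\<in>UNIV. \<Sum>a\<in>UNIV. f j a) = (\<Sum>x\<in>UNIV. \<Prod>j\<in>UNIV. f j (x j))"
  by (subst prod_sum_PiE) (simp_all add: PiE_UNIV_domain)

lemma hadamard_encoder_nth:
  "hadamard_encoder H $ x $ w = (\<Prod>j\<in>UNIV. H j $ x j $ w 1)"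
  by (simp add: hadamard_encoder_def tensor_vec_def ket_def matrix_vector_mult_def axis_def
      if_distrib[of "(*) _"] cong: if_cong)

text \<open>A product operator acts site by site, so it is absorbed into the encoder. As
  \<open>U j ** H j\<close> need not be Hadamard, this calculus is stated for arbitrary
  families.\<close>

lemma tensor_op_mult_hadamard_encoder:
  "tensor_op U ** hadamard_encoder H = hadamard_encoder (\<lambda>j. U j ** H j)"
  by (simp add: vec_eq_iff hadamard_encoder_nth matrix_matrix_mult_def tensor_op_def
      prod_sum_UNIV prod.distrib)

text \<open>Two independent families serve both uses: \<open>K = H\<close> for the isometry
  property, and \<open>K j = U j ** H j\<close> for the code condition.\<close>

lemma dagger_mult_hadamard_encoder_nth:
  "(dagger (hadamard_encoder H) ** hadamard_encoder K) $ v $ w =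
     (\<Prod>j\<in>UNIV. (dagger (H j) ** K j) $ v 1 $ w 1)"
  by (simp add: hadamard_encoder_nth matrix_matrix_mult_def dagger_def
      prod_sum_UNIV prod.distrib)

lemma fun_1_eq_iff: "v = w \<longleftrightarrow> v 1 = w 1" for v w :: "1 \<Rightarrow> 'a"
  by (metis (full_types) ext num1_eq1)

lemma is_isometry_hadamard_encoder:
  fixes H :: "'n::finite \<Rightarrow> complex ^ 'd::finite ^ 'd"
  assumes "\<And>j. is_unitary (H j)"
  shows "is_isometry (hadamard_encoder H)"
proof -
  have "dagger (H j) ** H j = mat 1" for j
    using assms by (simp add: is_unitary_def)
  \<comment> \<open>All factors are the same Kronecker delta; off the diagonal the product is
    \<open>0 ^ CARD('n)\<close>, which vanishes because \<open>'n\<close> is nonempty.\<close>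
  then have "(dagger (hadamard_encoder H) ** hadamard_encoder H) $ v $ w = mat 1 $ v $ w"
    for v w :: "1 \<Rightarrow> 'd"
    by (simp add: dagger_mult_hadamard_encoder_nth mat_def fun_1_eq_iff)
  then show ?thesis
    unfolding is_isometry_def vec_eq_iff by blast
qed

lemma hadamard_conjugate_diagonal_nth:
  fixes H D :: "complex ^ 'd::finite ^ 'd"
  assumes H: "is_hadamard H" and D: "\<And>i j. i \<noteq> j \<Longrightarrow> D $ i $ j = 0"
  shows "(dagger H ** (D ** H)) $ a $ a = (dagger H ** (D ** H)) $ b $ b"
proof -
  have DH: "(D ** H) $ x $ c = D $ x $ x * H $ x $ c" for x c
  proof -
    have "D $ x $ y * H $ y $ c = (if y = x then D $ x $ x * H $ x $ c else 0)" for y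
      by (cases "y = x") (simp_all add: D)
    then have "(\<Sum>y\<in>UNIV. D $ x $ y * H $ y $ c) =
        (\<Sum>y\<in>UNIV. if y = x then D $ x $ x * H $ x $ c else 0)"
      by (rule sum.cong[OF refl])
    then show ?thesis by (simp add: matrix_matrix_mult_def)
  qed
  have entry: "(dagger H ** (D ** H)) $ c $ c =
      (\<Sum>x\<in>UNIV. complex_of_real ((cmod (H $ x $ c))\<^sup>2) * D $ x $ x)" for c
    unfolding matrix_matrix_mult_def[of "dagger H"] complex_norm_square
    by (simp add: DH dagger_def ac_simps)
  have "cmod (H $ x $ a) = cmod (H $ x $ b)" for x
    using H unfolding is_hadamard_def by blast
  then show ?thesis
    by (simp only: entry)
qed

lemma dagger_mult: "dagger (A ** B) = dagger B ** dagger A"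
  by (simp add: dagger_def matrix_matrix_mult_def vec_eq_iff mult.commute)

lemma dagger_dagger: "dagger (dagger A) = A"
  by (simp add: dagger_def vec_eq_iff)

lemma dagger_mat_1: "dagger (mat 1) = mat 1"
  by (auto simp: dagger_def mat_def vec_eq_iff)

lemma is_unitary_mat_1: "is_unitary (mat 1)"
  by (simp add: is_unitary_def dagger_mat_1)

lemma is_unitary_dagger: "is_unitary A \<Longrightarrow> is_unitary (dagger A)"
  by (simp add: is_unitary_def dagger_dagger)

lemma is_unitary_mult:
  assumes "is_unitary A" "is_unitary B"
  shows "is_unitary (A ** B)"
proof -
  have "dagger B ** dagger A ** (A ** B) = dagger B ** (dagger A ** A) ** B"
    "A ** B ** (dagger B ** dagger A) = A ** (B ** dagger B) ** dagger A"
    by (simp_all add: matrix_mul_assoc)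
  with assms show ?thesis by (simp add: is_unitary_def dagger_mult)
qed

lemma group_unitary_group: "group unitary_group"
proof (rule groupI)
  fix x :: "complex ^ 'd::finite ^ 'd" assume "x \<in> carrier unitary_group"
  then show "\<exists>y\<in>carrier unitary_group. y \<otimes>\<^bsub>unitary_group\<^esub> x = \<one>\<^bsub>unitary_group\<^esub>"
    by (intro bexI[of _ "dagger x"])
      (auto simp: unitary_group_def is_unitary_dagger, simp add: is_unitary_def)
qed (simp_all add: unitary_group_def is_unitary_mult is_unitary_mat_1 matrix_mul_assoc)

text \<open>Left inverses in a group are unique, so the abstract \<open>inv\<close> is the adjoint;
  closure of a subgroup under \<open>inv\<close> can then be checked on entries.\<close>

lemma inv_unitary_group:
  fixes A :: "complex ^ 'd::finite ^ 'd"
  assumes "is_unitary A"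
  shows "inv\<^bsub>unitary_group\<^esub> A = dagger A"
proof (rule group.inv_equality[OF group_unitary_group])
  show "dagger A \<otimes>\<^bsub>unitary_group\<^esub> A = \<one>\<^bsub>unitary_group\<^esub>"
    using assms by (simp add: unitary_group_def is_unitary_def)
qed (use assms in \<open>simp_all add: unitary_group_def is_unitary_dagger\<close>)

lemma subgroup_diagonal_unitaries:
  "subgroup (diagonal_unitaries :: (complex ^ 'd::finite ^ 'd) set) unitary_group"
proof
  fix x y :: "complex ^ 'd ^ 'd"
  assume x: "x \<in> diagonal_unitaries" and y: "y \<in> diagonal_unitaries"
  have "(x ** y) $ i $ j = 0" if "i \<noteq> j" for i j
  proof -
    \<comment> \<open>An index \<open>k\<close> cannot equal both \<open>i\<close> and
      \<open>j\<close>, so one of the two factors lies off the diagonal.\<close>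
    have "x $ i $ k = 0 \<or> y $ k $ j = 0" for k
      using x y that by (cases "k = i") (auto simp: diagonal_unitaries_def)
    then have "(\<Sum>k\<in>UNIV. x $ i $ k * y $ k $ j) = 0"
      by (intro sum.neutral) simp
    then show ?thesis by (simp add: matrix_matrix_mult_def)
  qed
  then show "x \<otimes>\<^bsub>unitary_group\<^esub> y \<in> diagonal_unitaries"
    using x y by (simp add: diagonal_unitaries_def unitary_group_def is_unitary_mult)
next
  fix x :: "complex ^ 'd ^ 'd"
  assume "x \<in> diagonal_unitaries"
  then show "inv\<^bsub>unitary_group\<^esub> x \<in> diagonal_unitaries"
    by (auto simp: diagonal_unitaries_def inv_unitary_group is_unitary_dagger)
      (simp add: dagger_def)
qed (auto simp: diagonal_unitaries_def unitary_group_def is_unitary_mat_1, simp add: mat_def)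

theorem mainTheorem7:
  fixes H :: "'n::finite \<Rightarrow> complex ^ 'd::finite ^ 'd"
  assumes "\<And>j. is_hadamard (H j)"
  shows "is_quantum_code CARD('n) diagonal_unitaries
           (hadamard_encoder H :: complex ^ (1 \<Rightarrow> 'd) ^ ('n \<Rightarrow> 'd))"
proof -
  let ?i = "hadamard_encoder H :: complex ^ (1 \<Rightarrow> 'd) ^ ('n \<Rightarrow> 'd)"
  have unitary: "is_unitary (H j)" for j
    using assms by (simp add: is_hadamard_def)
  have "\<exists>c. dagger ?i ** e ** ?i = mat c" if local: "is_local_op CARD('n) diagonal_unitaries e"
    for e :: "complex ^ ('n \<Rightarrow> 'd) ^ ('n \<Rightarrow> 'd)"
  proof -
    obtain U where U: "\<And>j. U j \<in> diagonal_unitaries"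
      and card: "card {j. U j \<noteq> mat 1} < CARD('n)" and e: "e = tensor_op U"
      using local unfolding is_local_op_def by blast
    from card have "{j. U j \<noteq> mat 1} \<noteq> UNIV" by auto
    then obtain j0 where j0: "U j0 = mat 1" by auto
    \<comment> \<open>The bracketing matches the form left after \<open>U j\<close> is absorbed into
      the right-hand encoder.\<close>
    define M where "M j = dagger (H j) ** (U j ** H j)" for j
    have entry: "(dagger ?i ** e ** ?i) $ v $ w = (\<Prod>j\<in>UNIV. M j $ v 1 $ w 1)" for v w
      by (simp add: e M_def matrix_mul_assoc[symmetric] tensor_op_mult_hadamard_encoder
          dagger_mult_hadamard_encoder_nth)
    have off_diag: "(\<Prod>j\<in>UNIV. M j $ a $ b) = 0" if "a \<noteq> b" for a b
    proof (rule prod_zero)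
      have "M j0 = mat 1"
        using unitary[of j0] by (simp add: M_def j0 is_unitary_def)
      with that show "\<exists>j\<in>UNIV. M j $ a $ b = 0"
        by (intro bexI[of _ j0]) (simp_all add: mat_def)
    qed simp
    have diag: "M j $ a $ a = M j $ b $ b" for j a b
      unfolding M_def using U[of j]
      by (intro hadamard_conjugate_diagonal_nth assms) (simp add: diagonal_unitaries_def)
    \<comment> \<open>Here \<open>undefined\<close> is just some basis index; by \<open>diag\<close>
      any other gives the same value.\<close>
    define c where "c = (\<Prod>j\<in>UNIV. M j $ undefined $ undefined)"
    have "(\<Prod>j\<in>UNIV. M j $ a $ a) = c" for a
      unfolding c_def by (simp add: diag[of _ a undefined])
    with off_diag have "(dagger ?i ** e ** ?i) $ v $ w = mat c $ v $ w" for v w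
      unfolding entry by (simp add: mat_def fun_1_eq_iff)
    then have "dagger ?i ** e ** ?i = mat c"
      unfolding vec_eq_iff by blast
    then show ?thesis ..
  qed
  then show ?thesis
    unfolding is_quantum_code_def
    by (intro conjI allI impI subgroup_diagonal_unitaries is_isometry_hadamard_encoder unitary)
qed

end
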